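(* For any increasing range map $\delta$ and any $n \geq 0$, the map $\mathbf{e}_{\mathsf{Hi}_\delta}^{-1} \circ \mathbf{e}_{\mathsf{Ca}_\delta} : \mathsf{Ca}_\delta(n) \to \mathsf{Hi}_\delta(n)$ is both a bijection and a poset morphism.
   Context: A range map is a map $\delta : \mathbb{N}\setminus\{0\} \to \mathbb{N}$ (with $0 \in \mathbb{N}$); it is increasing if $\delta(i) < \delta(i+1)$ for all $i \geq 1$. A $\delta$-cliff of size $n$ is a word $u = u_1 \cdots u_n$ of integers with $0 \leq u_i \leq \delta(i)$ for all $i \in [n] := \{1,\dots,n\}$; $\mathsf{Cl}_\delta(n)$ is the set of $\delta$-cliffs of size $n$, and $|u|$ is the size of $u$. Cliffs of the same size are ordered by $u \preccurlyeq v$ iff $u_i \leq v_i$ for all $i$. $\mathsf{Hi}_\delta$ is the graded set (by size) of all $\delta$-cliffs $u$ with $u_i \leq u_{i+1}$ for all $i \in [|u|-1]$. $\mathsf{Ca}_\delta$ is the graded set of all $\delta$-cliffs $u$ such that $u_{i-j} \leq u_i - j$ for all $i \in [|u|]$ and all $j \in [u_i]$ satisfying $i-j \geq 1$. For a graded set $\mathcal{S}$, $\mathcal{S}(n)$ denotes its elements of size $n$, a poset for $\preccurlyeq$. For a graded subset $\mathcal{S}$ of $\bigsqcup_{n \geq 0}\mathsf{Cl}_\delta(n)$ that is closed by prefix (all prefixes of elements of $\mathcal{S}$ are in $\mathcal{S}$; this holds for $\mathsf{Hi}_\delta$ and $\mathsf{Ca}_\delta$), the elevation map $\mathbf{e}_{\mathcal{S}}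 : \mathcal{S}(n) \to \mathsf{Cl}_\delta(n)$ is defined by $\mathbf{e}_{\mathcal{S}}(u)_i := \#\{a \in \mathbb{N} : a < u_i \text{ and } u_1 \cdots u_{i-1} a \in \mathcal{S}\}$ for $i \in [n]$. This map is injective, and $\mathbf{e}_{\mathcal{S}}^{-1}$ denotes the inverse of the induced bijection from $\mathcal{S}(n)$ to its image. For increasing $\delta$, the images of $\mathbf{e}_{\mathsf{Hi}_\delta}$ and $\mathbf{e}_{\mathsf{Ca}_\delta}$ in size $n$ coincide (both are the set of $\delta$-cliffs $u$ of size $n$ with $u_1 + \cdots + u_k \leq \delta(k)$ for all $k \in [n]$), so the composition is well defined. A poset morphism is an order-preserving map. *)

theory Defs
  imports Main
begin

text \<open>
  A range map has domain \<open>\<nat> \<setminus> {0}\<close>. It is modelled by a function on all of \<^typ>\<open>nat\<close>; its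
  value at \<open>0\<close> is never used.
\<close>

definition increasing_range_map :: "(nat \<Rightarrow> nat) \<Rightarrow> bool" where
  "increasing_range_map \<delta> \<longleftrightarrow> (\<forall>i\<ge>1. \<delta> i < \<delta> (i + 1))"

text \<open>Letters of a word are indexed from \<open>1\<close>.\<close>

definition letter :: "nat list \<Rightarrow> nat \<Rightarrow> nat" where
  "letter u i = u ! (i - 1)"

definition cliffs :: "(nat \<Rightarrow> nat) \<Rightarrow> nat list set" where
  "cliffs \<delta> = {u. \<forall>i\<in>{1..length u}. letter u i \<le> \<delta> i}"

definition graded_part :: "nat list set \<Rightarrow> nat \<Rightarrow> nat list set" where
  "graded_part S n = {u \<in> S. length u = n}"

definition cliff_le :: "nat list \<Rightarrow> nat list \<Rightarrow> bool" where
  "cliff_le u v \<longleftrightarrow> length u = length v \<and> (\<forall>i\<in>{1..length u}. letter u i \<le> letter v i)"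

definition hills :: "(nat \<Rightarrow> nat) \<Rightarrow> nat list set" where
  "hills \<delta> = {u \<in> cliffs \<delta>. \<forall>i\<in>{1..<length u}. letter u i \<le> letter u (i + 1)}"

text \<open>Neither subtraction below truncates: \<open>j < i\<close> (that is, \<open>i - j \<ge> 1\<close>) and \<open>j \<le> letter u i\<close>.\<close>

definition canyons :: "(nat \<Rightarrow> nat) \<Rightarrow> nat list set" where
  "canyons \<delta> = {u \<in> cliffs \<delta>.
     \<forall>i\<in>{1..length u}. \<forall>j\<in>{1..letter u i}. j < i \<longrightarrow>
       letter u (i - j) \<le> letter u i - j}"

definition elevation :: "nat list set \<Rightarrow> nat list \<Rightarrow> nat list" where
  "elevation S u =
     map (\<lambda>i. card {a. a < letter u i \<and> take (i - 1) u @ [a] \<in> S}) [1..<length u + 1]"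

text \<open>
  The inverse of the elevation map from its image in size \<open>n\<close> back to \<open>S(n)\<close>; it is meaningful
  when the elevation map is injective there, and it is unspecified outside that image.
\<close>

definition elevation_inv :: "nat list set \<Rightarrow> nat \<Rightarrow> nat list \<Rightarrow> nat list" where
  "elevation_inv S n = the_inv_into (graded_part S n) (elevation S)"

end

theory Submission
  imports Defs
begin

text \<open>
  Everything rests on an explicit formula for \<open>\<phi> = e\<^sub>H\<^sub>i\<inverse> \<circ> e\<^sub>C\<^sub>a\<close>.

  Appending the letter \<open>a\<close> to a canyon \<open>u\<close> violates the canyon condition against the letter at
  position \<open>k\<close> exactly when \<open>d \<le> a < d + u\<^sub>k\<close>, where \<open>d = \<bar>u\<bar> + 1 - k\<close> is the distance to the new
  position. So \<open>u @ [a]\<close> is a canyon iff \<open>a\<close> is within range and avoids a union \<open>F u\<close> of such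
  intervals, the set \<open>shadow u\<close> below. When \<open>a\<close> is appended, all distances grow by one and the new
  interval \<open>{1..a}\<close> appears, so \<open>F (u @ [a]) = (F u + 1) \<union> {1..a}\<close>. The elements gained are
  the successors of the points of \<open>{0..<a} - F u\<close>, and these points are precisely
  what the last letter of the elevation of \<open>u @ [a]\<close> counts. Hence the partial sums of the elevation
  of a canyon are the cardinalities of the shadows of its prefixes.

  For hills the elevation is the sequence of differences of consecutive letters, and its inverse
  takes partial sums. Therefore \<open>\<phi> u\<close> has \<open>i\<close>-th letter \<open>card (F (u\<^sub>1 \<dots> u\<^sub>i))\<close>
  (\<open>elevation_hill_of_canyon\<close>).

  The strict growth of \<open>\<delta>\<close> is what makes the values of \<open>\<phi>\<close> hills within range: the shift by one in
  the recursion for \<open>F\<close> is absorbed by the growth of \<open>\<delta>\<close>, so the shadow of a canyon of size \<open>n\<close>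
  stays inside \<open>{1..\<delta> n}\<close> (\<open>shadow_le_range\<close>).

  The formula shows that \<open>\<phi>\<close> preserves the order, because larger letters produce larger shadows
  (\<open>shadow_mono\<close>). Injectivity is that of elevation maps (\<open>inj_on_elevation\<close>). For
  surjectivity a preimage is built letter by letter: a hill letter \<open>b\<close> asks for an increment of
  \<open>b - card (F u)\<close>, and as \<open>F u\<close> cannot block more than \<open>card (F u)\<close> letters, some permitted letter
  \<open>a \<le> b\<close> has that many permitted letters below it (\<open>hill_of_canyon_surj\<close>).
\<close>

section \<open>Words built by appending letters\<close>

lemma letter_append_old: "i \<in> {1..length u} \<Longrightarrow> letter (u @ [a]) i = letter u i"
  by (auto simp: letter_def nth_append)

lemma letter_append_new: "letter (u @ [a]) (Suc (length u)) = a"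
  by (simp add: letter_def)

lemma atLeastAtMost_length_append: "{1..length (u @ [a])} = insert (Suc (length u)) {1..length u}"
  by auto

lemma append_in_cliffs_iff:
  "u @ [a] \<in> cliffs \<delta> \<longleftrightarrow> u \<in> cliffs \<delta> \<and> a \<le> \<delta> (Suc (length u))"
  unfolding cliffs_def mem_Collect_eq atLeastAtMost_length_append
  by (auto simp: letter_append_new letter_append_old)

lemma elevation_append:
  "elevation S (u @ [a]) = elevation S u @ [card {b. b < a \<and> u @ [b] \<in> S}]"
  by (auto simp: elevation_def letter_append_new letter_append_old)

lemma length_elevation [simp]: "length (elevation S u) = length u"
  by (simp add: elevation_def del: upt_Suc)

text \<open>
  Two words with equal elevation agree up to their last letters by induction. If the last letters
  differed, the smaller one would itself be counted for the larger word, but not for the smaller.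
\<close>

lemma elevation_eq_imp_eq:
  assumes prefix_closed: "\<And>w x. w @ [x] \<in> S \<Longrightarrow> w \<in> S"
  shows "u \<in> S \<Longrightarrow> v \<in> S \<Longrightarrow> length u = length v \<Longrightarrow> elevation S u = elevation S v \<Longrightarrow> u = v"
proof (induction u arbitrary: v rule: rev_induct)
  case Nil
  then show ?case by simp
next
  case (snoc a u)
  from snoc.prems(3) obtain v' b where v: "v = v' @ [b]"
    by (cases v rule: rev_cases) auto
  have "u = v'"
    using snoc.prems snoc.IH[of v'] prefix_closed by (auto simp: v elevation_append)
  moreover
  have count: "card {c. c < x \<and> u @ [c] \<in> S} < card {c. c < y \<and> u @ [c] \<in> S}"
    if "u @ [x] \<in> S" "x < y" for x y
    using that by (intro psubset_card_mono) auto
  have "a = b"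
    using snoc.prems count[of a b] count[of b a] \<open>u = v'\<close>
    by (cases a b rule: linorder_cases) (auto simp: v elevation_append)
  ultimately show ?case by (simp add: v)
qed

lemma inj_on_elevation:
  assumes "\<And>w x. w @ [x] \<in> S \<Longrightarrow> w \<in> S"
  shows "inj_on (elevation S) (graded_part S n)"
  using elevation_eq_imp_eq[of S] assms by (auto simp: inj_on_def graded_part_def)

section \<open>Hills\<close>

text \<open>
  The convention that a hill is preceded by the letter \<open>0\<close> makes the first letter no exception.
\<close>

definition last_or_0 :: "nat list \<Rightarrow> nat" where
  "last_or_0 w = (if w = [] then 0 else last w)"

lemma append_in_hills_iff:
  "w @ [b] \<in> hills \<delta> \<longleftrightarrow> w \<in> hills \<delta> \<and> last_or_0 w \<le> b \<and> b \<le> \<delta> (Suc (length w))"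
proof (cases w rule: rev_cases)
  case Nil
  then show ?thesis
    by (auto simp: hills_def append_in_cliffs_iff[of "[]", simplified] last_or_0_def)
next
  case (snoc w' c)
  have split: "{1..<length (w @ [b])} = insert (length w) {1..<length w}"
    using snoc by auto
  have last: "letter (w @ [b]) (length w) = last_or_0 w"
    "letter (w @ [b]) (Suc (length w)) = b"
    by (simp_all add: snoc letter_def last_or_0_def nth_append)
  show ?thesis
    unfolding hills_def mem_Collect_eq split
    by (auto simp: last append_in_cliffs_iff letter_append_old)
qed

lemma elevation_hills_append:
  assumes "w @ [b] \<in> hills \<delta>"
  shows "elevation (hills \<delta>) (w @ [b]) = elevation (hills \<delta>) w @ [b - last_or_0 w]"
proof -
  have "{c. c < b \<and> w @ [c] \<in> hills \<delta>} = {last_or_0 w..<b}"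
    using assms by (auto simp: append_in_hills_iff)
  then show ?thesis by (simp add: elevation_append)
qed

section \<open>Canyons and shadows\<close>

text \<open>The letters that the canyon condition excludes from the position after the word \<open>u\<close>.\<close>

definition shadow :: "nat list \<Rightarrow> nat set" where
  "shadow u = (\<Union>k\<in>{1..length u}. {Suc (length u) - k..<Suc (length u) - k + letter u k})"

lemma finite_shadow [simp]: "finite (shadow u)"
  by (simp add: shadow_def)

lemma zero_notin_shadow [simp]: "0 \<notin> shadow u"
  by (auto simp: shadow_def)

lemma shadow_Nil [simp]: "shadow [] = {}"
  by (simp add: shadow_def)

lemma shadow_append: "shadow (u @ [a]) = Suc ` shadow u \<union> {1..a}"
proof -
  have "{Suc (length (u @ [a])) - k..<Suc (length (u @ [a])) - k + letter (u @ [a]) k}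
      = Suc ` {Suc (length u) - k..<Suc (length u) - k + letter u k}"
    if "k \<in> {1..length u}" for k
    using that by (simp add: letter_append_old image_Suc_atLeastLessThan Suc_diff_le)
  then have "(\<Union>k\<in>{1..length u}. {Suc (length (u @ [a])) - k..<
        Suc (length (u @ [a])) - k + letter (u @ [a]) k})
      = Suc ` shadow u"
    by (simp add: shadow_def image_UN)
  moreover have "{Suc (length (u @ [a])) - Suc (length u)..<
      Suc (length (u @ [a])) - Suc (length u) + letter (u @ [a]) (Suc (length u))} = {1..a}"
    by (auto simp: letter_append_new)
  ultimately show ?thesis
    unfolding shadow_def[of "u @ [a]"] atLeastAtMost_length_append UN_insert by blast
qed

text \<open>
  The size of the shadow grows by the number of permitted letters below the appended one; this
  identifies partial sums of elevations with sizes of shadows.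
\<close>

lemma card_shadow_append: "card (shadow (u @ [a])) = card (shadow u) + card ({..<a} - shadow u)"
proof -
  have "{1..a} = Suc ` {..<a}"
    by (simp add: lessThan_atLeast0 image_Suc_atLeastLessThan atLeastLessThanSuc_atLeastAtMost)
  then have "shadow (u @ [a]) = Suc ` (shadow u \<union> ({..<a} - shadow u))"
    unfolding shadow_append by blast
  then have "card (shadow (u @ [a])) = card (shadow u \<union> ({..<a} - shadow u))"
    by (simp add: card_image)
  also have "\<dots> = card (shadow u) + card ({..<a} - shadow u)"
    by (rule card_Un_disjoint) auto
  finally show ?thesis .
qed

lemma shadow_mono:
  assumes "cliff_le u v"
  shows "shadow u \<subseteq> shadow v"
proof -
  have len: "length u = length v"
    using assms by (simp add: cliff_le_def)
  have "letter u k \<le> letter v k" if "k \<in> {1..length v}" for k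
    using assms that by (simp add: cliff_le_def)
  then show ?thesis
    unfolding shadow_def len
    by (intro UN_mono ivl_subset[THEN iffD2] disjI2 conjI add_mono) auto
qed

lemma append_in_canyons_iff:
  "u @ [a] \<in> canyons \<delta> \<longleftrightarrow> u \<in> canyons \<delta> \<and> a \<notin> shadow u \<and> a \<le> \<delta> (Suc (length u))"
proof -
  let ?n = "Suc (length u)"
  have old: "(\<forall>j\<in>{1..letter (u @ [a]) i}. j < i \<longrightarrow>
        letter (u @ [a]) (i - j) \<le> letter (u @ [a]) i - j)
      \<longleftrightarrow> (\<forall>j\<in>{1..letter u i}. j < i \<longrightarrow> letter u (i - j) \<le> letter u i - j)"
    if "i \<in> {1..length u}" for i
  proof -
    have "letter (u @ [a]) (i - j) = letter u (i - j)" if "j < i" for j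
      using that \<open>i \<in> _\<close> by (intro letter_append_old) auto
    then show ?thesis using that by (auto simp: letter_append_old)
  qed
  have new: "(\<forall>j\<in>{1..letter (u @ [a]) ?n}. j < ?n \<longrightarrow>
        letter (u @ [a]) (?n - j) \<le> letter (u @ [a]) ?n - j) \<longleftrightarrow> a \<notin> shadow u"
  proof -
    have "letter (u @ [a]) (?n - j) = letter u (?n - j)" if "1 \<le> j" "j \<le> length u" for j
      using that by (intro letter_append_old) auto
    then have "(\<forall>j\<in>{1..letter (u @ [a]) ?n}. j < ?n \<longrightarrow>
        letter (u @ [a]) (?n - j) \<le> letter (u @ [a]) ?n - j)
      \<longleftrightarrow> (\<forall>j\<in>{1..length u}. j \<le> a \<longrightarrow> letter u (?n - j) \<le> a - j)"
      by (auto simp: letter_append_new)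
    (* The distance j is replaced by the position k it leads to. *)
    also have "\<dots> \<longleftrightarrow> (\<forall>k\<in>{1..length u}. ?n - k \<le> a \<longrightarrow> letter u k \<le> a - (?n - k))"
    proof (intro iffI ballI impI)
      fix k assume "\<forall>j\<in>{1..length u}. j \<le> a \<longrightarrow> letter u (?n - j) \<le> a - j"
        and "k \<in> {1..length u}" "?n - k \<le> a"
      moreover from this have "?n - k \<in> {1..length u}" "?n - (?n - k) = k"
        by auto
      ultimately show "letter u k \<le> a - (?n - k)"
        by metis
    next
      fix j assume "\<forall>k\<in>{1..length u}. ?n - k \<le> a \<longrightarrow> letter u k \<le> a - (?n - k)"
        and "j \<in> {1..length u}" "j \<le> a"
      moreover from this have "?n - j \<in> {1..length u}" "?n - (?n - j) = j"
        by auto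
      ultimately show "letter u (?n - j) \<le> a - j"
        by metis
    qed
    also have "\<dots> \<longleftrightarrow> a \<notin> shadow u"
      unfolding shadow_def by (auto simp: not_less le_diff_conv2 add.commute)
    finally show ?thesis .
  qed
  show ?thesis
    unfolding canyons_def mem_Collect_eq atLeastAtMost_length_append ball_simps new
    using old by (auto simp: append_in_cliffs_iff)
qed

lemma elevation_canyons_append:
  assumes "u @ [a] \<in> canyons \<delta>"
  shows "elevation (canyons \<delta>) (u @ [a]) = elevation (canyons \<delta>) u @ [card ({..<a} - shadow u)]"
proof -
  have "{b. b < a \<and> u @ [b] \<in> canyons \<delta>} = {..<a} - shadow u"
    using assms by (auto simp: append_in_canyons_iff)
  then show ?thesis by (simp add: elevation_append)
qed

text \<open>
  Appending a letter shifts the shadow by one, and an increasing range map grows by at least one.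
\<close>

lemma shadow_le_range:
  assumes \<delta>: "increasing_range_map \<delta>"
  shows "u \<in> cliffs \<delta> \<Longrightarrow> x \<in> shadow u \<Longrightarrow> x \<le> \<delta> (length u)"
proof (induction u arbitrary: x rule: rev_induct)
  case Nil
  then show ?case by simp
next
  case (snoc a u)
  show ?case
  proof (cases "x \<in> Suc ` shadow u")
    case True
    then obtain y where y: "y \<in> shadow u" "x = Suc y" by blast
    then have "y \<le> \<delta> (length u)"
      using snoc by (simp add: append_in_cliffs_iff)
    moreover have "length u \<ge> 1"
      using y by (cases u) auto
    ultimately show ?thesis
      using \<delta> y by (fastforce simp: increasing_range_map_def)
  next
    case False
    then show ?thesis
      using snoc.prems by (auto simp: shadow_append append_in_cliffs_iff)
  qed
qed

lemma card_shadow_le_range: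
  assumes "increasing_range_map \<delta>" "u \<in> cliffs \<delta>"
  shows "card (shadow u) \<le> \<delta> (length u)"
proof -
  have "x \<in> {1..\<delta> (length u)}" if "x \<in> shadow u" for x
    using shadow_le_range[OF assms that] that by (cases x) auto
  then have "shadow u \<subseteq> {1..\<delta> (length u)}" by blast
  then have "card (shadow u) \<le> card {1..\<delta> (length u)}"
    by (intro card_mono) auto
  then show ?thesis by simp
qed

section \<open>From canyons to hills\<close>

definition hill_of_canyon :: "nat list \<Rightarrow> nat list" where
  "hill_of_canyon u = map (\<lambda>i. card (shadow (take i u))) [1..<length u + 1]"

lemma length_hill_of_canyon [simp]: "length (hill_of_canyon u) = length u"
  by (simp add: hill_of_canyon_def del: upt_Suc)

lemma hill_of_canyon_append:
  "hill_of_canyon (u @ [a]) = hill_of_canyon u @ [card (shadow (u @ [a]))]"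
  by (auto simp: hill_of_canyon_def)

lemma last_or_0_hill_of_canyon: "last_or_0 (hill_of_canyon u) = card (shadow u)"
  by (cases u rule: rev_cases) (auto simp: last_or_0_def hill_of_canyon_append hill_of_canyon_def)

lemma hill_of_canyon_in_hills:
  assumes "increasing_range_map \<delta>"
  shows "u \<in> canyons \<delta> \<Longrightarrow> hill_of_canyon u \<in> hills \<delta>"
proof (induction u rule: rev_induct)
  case Nil
  then show ?case by (simp add: hill_of_canyon_def hills_def cliffs_def)
next
  case (snoc a u)
  have "u @ [a] \<in> cliffs \<delta>"
    using snoc.prems by (simp add: canyons_def)
  then have "card (shadow (u @ [a])) \<le> \<delta> (length (u @ [a]))"
    by (rule card_shadow_le_range[OF assms])
  then show ?case
    using snoc
    by (simp add: hill_of_canyon_append append_in_hills_iff append_in_canyons_iff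
        last_or_0_hill_of_canyon card_shadow_append)
qed

text \<open>
  Differences of consecutive shadow sizes are the letters of the elevation of the canyon, so
  \<^const>\<open>hill_of_canyon\<close> is the composition under study.
\<close>

lemma elevation_hill_of_canyon:
  assumes "increasing_range_map \<delta>"
  shows "u \<in> canyons \<delta> \<Longrightarrow>
    elevation (hills \<delta>) (hill_of_canyon u) = elevation (canyons \<delta>) u"
proof (induction u rule: rev_induct)
  case Nil
  then show ?case by (simp add: hill_of_canyon_def elevation_def)
next
  case (snoc a u)
  have "hill_of_canyon u @ [card (shadow (u @ [a]))] \<in> hills \<delta>"
    using hill_of_canyon_in_hills[OF assms snoc.prems] by (simp add: hill_of_canyon_append)
  then show ?case
    using snoc
    by (simp add: hill_of_canyon_append elevation_hills_append elevation_canyons_append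
        append_in_canyons_iff last_or_0_hill_of_canyon card_shadow_append)
qed

lemma hill_of_canyon_mono:
  assumes "cliff_le u v"
  shows "cliff_le (hill_of_canyon u) (hill_of_canyon v)"
proof -
  have len: "length u = length v"
    using assms by (simp add: cliff_le_def)
  have "cliff_le (take i u) (take i v)" for i
    using assms by (auto simp: cliff_le_def letter_def)
  then have "card (shadow (take i u)) \<le> card (shadow (take i v))" for i
    by (intro card_mono shadow_mono) simp_all
  then show ?thesis
    by (auto simp: cliff_le_def hill_of_canyon_def letter_def len simp del: upt_Suc)
qed

section \<open>Surjectivity\<close>

text \<open>
  The sought element is the one with index \<open>d\<close> in the complement of \<open>F\<close>, counted from zero: the
  first \<open>a\<close> for which more than \<open>d\<close> elements of the complement are at most \<open>a\<close>.
\<close>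

lemma ex_notin_with_card_below:
  fixes F :: "nat set"
  assumes "finite F" and "d + card F \<le> m"
  shows "\<exists>a\<le>m. a \<notin> F \<and> card ({..<a} - F) = d"
proof -
  define a where "a = (LEAST a. d < card ({..a} - F))"
  have "card {..m} - card F \<le> card ({..m} - F)"
    using assms(1) by (rule diff_card_le_card_Diff)
  then have m: "d < card ({..m} - F)"
    using assms(2) by simp
  have "a \<le> m"
    unfolding a_def using m by (rule Least_le)
  have above: "d < card ({..a} - F)"
    unfolding a_def using m by (rule LeastI)
  have below: "card ({..<a} - F) \<le> d"
  proof (cases a)
    case (Suc b)
    then have "\<not> d < card ({..b} - F)"
      using not_less_Least[of b "\<lambda>a. d < card ({..a} - F)"] by (simp add: a_def)
    then show ?thesis
      by (simp add: Suc lessThan_Suc_atMost)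
  qed simp
  have "a \<notin> F"
  proof
    assume "a \<in> F"
    then have "{..a} - F = {..<a} - F"
      by (auto simp: le_less)
    then show False
      using above below by simp
  qed
  moreover from this have "{..a} - F = insert a ({..<a} - F)"
    by (auto simp: le_less)
  then have "card ({..a} - F) = Suc (card ({..<a} - F))"
    by simp
  then have "card ({..<a} - F) = d"
    using above below by simp
  ultimately show ?thesis
    using \<open>a \<le> m\<close> by blast
qed

text \<open>
  If the canyon \<open>u\<close> is a preimage of a hill \<open>w\<close>, then the last letter of \<open>w\<close> is the size of the
  shadow of \<open>u\<close>. Among the letters \<open>0, \<dots>, b\<close>, for the next hill letter \<open>b\<close>, more than
  \<open>b - card (shadow u)\<close> avoid the shadow, so the one with that index can be appended to \<open>u\<close>; it
  respects the range because \<open>b\<close> does.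
\<close>

lemma hill_of_canyon_surj: "w \<in> hills \<delta> \<Longrightarrow> \<exists>u\<in>canyons \<delta>. hill_of_canyon u = w"
proof (induction w rule: rev_induct)
  case Nil
  have "[] \<in> canyons \<delta>" by (simp add: canyons_def cliffs_def)
  then show ?case by (intro bexI[of _ "[]"]) (auto simp: hill_of_canyon_def)
next
  case (snoc b w)
  then obtain u where u: "u \<in> canyons \<delta>" "hill_of_canyon u = w"
    by (auto simp: append_in_hills_iff)
  have b: "card (shadow u) \<le> b" "b \<le> \<delta> (Suc (length u))"
    using snoc.prems u(2) last_or_0_hill_of_canyon[of u]
    by (auto simp: append_in_hills_iff)
  then have "\<exists>a\<le>b. a \<notin> shadow u \<and>
      card ({..<a} - shadow u) = b - card (shadow u)"
    by (intro ex_notin_with_card_below) auto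
  then obtain a where a: "a \<le> b" "a \<notin> shadow u"
    "card ({..<a} - shadow u) = b - card (shadow u)"
    by blast
  have "u @ [a] \<in> canyons \<delta>"
    using u a b by (simp add: append_in_canyons_iff)
  moreover have "hill_of_canyon (u @ [a]) = w @ [b]"
    using u a b by (simp add: hill_of_canyon_append card_shadow_append)
  ultimately show ?case by blast
qed

section \<open>The comparison of canyons and hills\<close>

theorem theorem2p3p5:
  fixes \<delta> :: "nat \<Rightarrow> nat" and n :: nat
  assumes "increasing_range_map \<delta>"
  shows "bij_betw (elevation_inv (hills \<delta>) n \<circ> elevation (canyons \<delta>))
           (graded_part (canyons \<delta>) n) (graded_part (hills \<delta>) n)
         \<and> monotone_on (graded_part (canyons \<delta>) n) cliff_le cliff_le
             (elevation_inv (hills \<delta>) n \<circ> elevation (canyons \<delta>))"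
proof -
  let ?C = "graded_part (canyons \<delta>) n" and ?H = "graded_part (hills \<delta>) n"
  let ?f = "elevation_inv (hills \<delta>) n \<circ> elevation (canyons \<delta>)"
  have inj_hills: "inj_on (elevation (hills \<delta>)) ?H"
    by (rule inj_on_elevation) (simp add: append_in_hills_iff)
  have inj_canyons: "inj_on (elevation (canyons \<delta>)) ?C"
    by (rule inj_on_elevation) (simp add: append_in_canyons_iff)
  have into: "hill_of_canyon u \<in> ?H"
    and elev: "elevation (hills \<delta>) (hill_of_canyon u) = elevation (canyons \<delta>) u"
    if "u \<in> ?C" for u
    using that hill_of_canyon_in_hills[OF assms] elevation_hill_of_canyon[OF assms]
    by (auto simp: graded_part_def)
  have f: "?f u = hill_of_canyon u" if "u \<in> ?C" for u
    using the_inv_into_f_f[OF inj_hills into[OF that]] elev[OF that]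
    by (simp add: elevation_inv_def)
  have "inj_on hill_of_canyon ?C"
    using inj_canyons elev by (metis inj_on_def)
  moreover have "hill_of_canyon ` ?C = ?H"
  proof
    show "hill_of_canyon ` ?C \<subseteq> ?H" using into by blast
    show "?H \<subseteq> hill_of_canyon ` ?C"
      using hill_of_canyon_surj[of _ \<delta>] by (fastforce simp: graded_part_def)
  qed
  ultimately have "bij_betw hill_of_canyon ?C ?H"
    by (simp add: bij_betw_def)
  then have "bij_betw ?f ?C ?H"
    using f by (simp cong: bij_betw_cong)
  moreover have "monotone_on ?C cliff_le cliff_le ?f"
    by (rule monotone_onI) (simp only: f hill_of_canyon_mono)
  ultimately show ?thesis by blast
qed

end
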